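(* Let $\{\mathfrak{p}_{1},\ldots,\mathfrak{p}_{n}\}$ be a finite set of distinct prime ideals of a zero dimensional commutative ring $R$, where $n\geqslant1$. Then there exists a set $\{e_{1},\ldots,e_{n}\}$ of orthogonal idempotents of $R$ such that $\mathfrak{p}_{i}\in D(e_{i})$ for each $i$ and $\sum_{i=1}^{n}e_{i}=1$.
   Context: All rings are commutative with $1$. A ring is zero dimensional if its Krull dimension is $0$ (every prime ideal is maximal). For $f\in R$, $D(f)=\{\mathfrak{p}\in\operatorname{Spec}(R): f\notin\mathfrak{p}\}$. A set of orthogonal idempotents $\{e_1,\ldots,e_n\}$ consists of distinct idempotents with $e_{i}e_{k}=0$ for $i\neq k$. *)

theory Defs
  imports "HOL-Algebra.Ring_Divisibility" "HOL-Library.Extended_Real"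
begin

definition Spec :: "('a, 'b) ring_scheme \<Rightarrow> 'a set set" where
  "Spec R = {P. primeideal P R}"

definition basic_open :: "('a, 'b) ring_scheme \<Rightarrow> 'a \<Rightarrow> 'a set set" where
  "basic_open R f = {P \<in> Spec R. f \<notin> P}"

text \<open>The supremum of the lengths \<open>n\<close> of strictly increasing chains
  \<open>P 0 \<subset> \<dots> \<subset> P n\<close> of prime ideals. In \<^typ>\<open>ereal\<close> the supremum of the empty set is
  \<open>-\<infinity>\<close>, so this is the value for the zero ring, which therefore is not zero dimensional.\<close>

definition krull_dim :: "('a, 'b) ring_scheme \<Rightarrow> ereal" where
  "krull_dim R = Sup {ereal (real n) | n. \<exists>P. (\<forall>i\<le>n. P i \<in> Spec R) \<and> (\<forall>i<n. P i \<subset> P (Suc i))}"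

definition zero_dimensional :: "('a, 'b) ring_scheme \<Rightarrow> bool" where
  "zero_dimensional R \<longleftrightarrow> krull_dim R = 0"

text \<open>Injectivity expresses that the listed idempotents are distinct.\<close>

definition orthogonal_idempotents ::
  "('a, 'b) ring_scheme \<Rightarrow> 'i set \<Rightarrow> ('i \<Rightarrow> 'a) \<Rightarrow> bool" where
  "orthogonal_idempotents R I e \<longleftrightarrow>
     (\<forall>i\<in>I. e i \<in> carrier R \<and> e i \<otimes>\<^bsub>R\<^esub> e i = e i) \<and>
     (\<forall>i\<in>I. \<forall>k\<in>I. i \<noteq> k \<longrightarrow> e i \<otimes>\<^bsub>R\<^esub> e k = \<zero>\<^bsub>R\<^esub>) \<and>
     inj_on e I"

lemma (in ring) exists_maximalideal:
  assumes J: "ideal J R" "J \<noteq> carrier R"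
  shows "\<exists>M. maximalideal M R \<and> J \<subseteq> M"
proof -
  define A where "A = {I. ideal I R \<and> J \<subseteq> I \<and> \<one> \<notin> I}"
  have one: "\<one> \<notin> I \<longleftrightarrow> I \<noteq> carrier R" if "ideal I R" for I
    using that ideal.one_imp_carrier by blast
  have "A \<noteq> {}" using J one unfolding A_def by auto
  moreover have "\<Union>C \<in> A" if "C \<noteq> {}" "subset.chain A C" for C
  proof -
    have C: "C \<subseteq> A" using that(2) by (simp add: subset_chain_def)
    then have "subset.chain {I. ideal I R} C"
      using that(2) by (auto simp: subset_chain_def A_def)
    then have "ideal (\<Union>C) R" using chain_Union_is_ideal[of C] that(1) by simp
    moreover have "J \<subseteq> \<Union>C" "\<one> \<notin> \<Union>C" using C that(1) unfolding A_def by blast+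
    ultimately show ?thesis unfolding A_def by blast
  qed
  ultimately obtain M where M: "M \<in> A" and max: "\<And>X. X \<in> A \<Longrightarrow> M \<subseteq> X \<Longrightarrow> X = M"
    using subset_Zorn_nonempty[of A] by blast
  have "maximalideal M R"
  proof (rule maximalidealI)
    show "ideal M R" "carrier R \<noteq> M" using M one unfolding A_def by auto
    show "I = M \<or> I = carrier R" if "ideal I R" "M \<subseteq> I" "I \<subseteq> carrier R" for I
      using that max[of I] M one unfolding A_def by blast
  qed
  then show ?thesis using M unfolding A_def by blast
qed

text \<open>For nonzero rings, dimension zero means that every prime ideal is maximal.\<close>

lemma zero_dimensional_iff:
  fixes R (structure)
  assumes "cring R" "\<one> \<noteq> \<zero>"
  shows "zero_dimensional R \<longleftrightarrow> (\<forall>P\<in>Spec R. maximalideal P R)"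
proof -
  interpret cring R by fact
  define L where "L = {n. \<exists>P. (\<forall>i\<le>n. P i \<in> Spec R) \<and> (\<forall>i<n. P i \<subset> P (Suc i))}"
  have dim: "krull_dim R = Sup ((\<lambda>n. ereal (real n)) ` L)"
    unfolding krull_dim_def L_def by (rule arg_cong[of _ _ Sup]) auto
  have "{\<zero>} \<noteq> carrier R" using assms(2) by auto
  then obtain M where "maximalideal M R" using exists_maximalideal[OF zeroideal] by blast
  then have "M \<in> Spec R" using maximalideal_prime by (simp add: Spec_def)
  then have 0: "0 \<in> L" unfolding L_def by auto
  show ?thesis
  proof
    assume zd: "zero_dimensional R"
    have L: "n = 0" if "n \<in> L" for n
    proof -
      have "ereal (real n) \<le> krull_dim R" unfolding dim using that by (intro Sup_upper) auto
      then show ?thesis using zd by (simp add: zero_dimensional_def)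
    qed
    show "\<forall>P\<in>Spec R. maximalideal P R"
    proof
      fix P assume P: "P \<in> Spec R"
      then have "ideal P R" "P \<noteq> carrier R"
        using primeideal.axioms(1) primeideal.I_notcarr unfolding Spec_def by blast+
      then obtain M where M: "maximalideal M R" "P \<subseteq> M" using exists_maximalideal by blast
      have "P = M"
      proof (rule ccontr)
        assume "P \<noteq> M"
        then have "1 \<in> L"
          unfolding L_def mem_Collect_eq using P M maximalideal_prime
          by (intro exI[of _ "\<lambda>i::nat. if i = 0 then P else M"]) (simp add: Spec_def psubset_eq)
        then show False using L by fastforce
      qed
      then show "maximalideal P R" using M by simp
    qed
  next
    assume max: "\<forall>P\<in>Spec R. maximalideal P R"
    have "n = 0" if "n \<in> L" for n
    proof (rule ccontr)
      assume "n \<noteq> 0"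
      from that obtain P where "\<forall>i\<le>n. P i \<in> Spec R" "\<forall>i<n. P i \<subset> P (Suc i)"
        unfolding L_def by blast
      with \<open>n \<noteq> 0\<close> have P: "P 0 \<in> Spec R" "P 1 \<in> Spec R" "P 0 \<subset> P 1"
        by (auto simp: Suc_le_eq)
      then have "primeideal (P 1) R" by (simp add: Spec_def)
      then have "ideal (P 1) R" "P 1 \<noteq> carrier R"
        using primeideal.axioms(1) primeideal.I_notcarr by blast+
      moreover have "P 1 \<subseteq> carrier R"
        using calculation(1) additive_subgroup.a_subset ideal.axioms(1) by blast
      ultimately show False using P max maximalideal.I_maximal[of "P 0" R "P 1"] by blast
    qed
    then have "L = {0}" using 0 by auto
    then show "zero_dimensional R" by (simp add: zero_dimensional_def dim)
  qed
qed

end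

theory Submission
  imports Defs
begin

text \<open>In a zero dimensional ring every element \<open>x\<close> satisfies \<open>x\<^sup>m = x\<^sup>m x y\<close> for some \<open>m\<close> and \<open>y\<close>:
  otherwise the multiplicative set of all \<open>x\<^sup>m (1 - x y)\<close> avoids \<open>0\<close>, hence avoids some prime,
  which is maximal and does not contain \<open>x\<close>, and so contains some \<open>1 - x y\<close>. Then the power
  of \<open>x y\<close> with exponent \<open>m + 1\<close> is an
  idempotent lying in exactly the same primes as \<open>x\<close>, so distinct primes are separated by
  idempotents. Multiplying such idempotents gives, for a prime \<open>q\<close> and finitely many others, an
  idempotent \<open>g\<close> outside \<open>q\<close> but in all the others. The system is then built by adding one prime
  at a time, replacing \<open>(e\<^sub>i)\<close> by \<open>((1 - g) e\<^sub>i)\<close> together with \<open>g\<close>.\<close>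

text \<open>Zorn's lemma gives an ideal \<open>P\<close> that is maximal among those containing
  \<open>J\<close> and missing \<open>S\<close>. If \<open>a\<close> and \<open>b\<close> lie
  outside \<open>P\<close>, then both \<open>P + (a)\<close> and \<open>P + (b)\<close> meet
  \<open>S\<close>; the product of two such elements lies in \<open>S\<close>, and it would lie in
  \<open>P\<close> if \<open>a \<otimes> b\<close> did.\<close>

lemma (in cring) exists_primeideal_disjoint:
  assumes S: "submonoid S R" and J: "ideal J R" "J \<inter> S = {}"
  shows "\<exists>P. primeideal P R \<and> J \<subseteq> P \<and> P \<inter> S = {}"
proof -
  interpret S: submonoid S R by fact
  define A where "A = {I. ideal I R \<and> J \<subseteq> I \<and> I \<inter> S = {}}"
  have "A \<noteq> {}" using J unfolding A_def by auto
  moreover have "\<Union>C \<in> A" if "C \<noteq> {}" "subset.chain A C" for C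
  proof -
    have C: "C \<subseteq> A" using that(2) by (simp add: subset_chain_def)
    then have "subset.chain {I. ideal I R} C"
      using that(2) by (auto simp: subset_chain_def A_def)
    then have "ideal (\<Union>C) R" using chain_Union_is_ideal[of C] that(1) by simp
    moreover have "J \<subseteq> \<Union>C" "\<Union>C \<inter> S = {}" using C that(1) unfolding A_def by blast+
    ultimately show ?thesis unfolding A_def by blast
  qed
  ultimately obtain P where P: "P \<in> A" and max: "\<And>X. X \<in> A \<Longrightarrow> P \<subseteq> X \<Longrightarrow> X = P"
    using subset_Zorn_nonempty[of A] by blast
  have id: "ideal P R" and dis: "P \<inter> S = {}" and JP: "J \<subseteq> P" using P unfolding A_def by auto
  interpret P: ideal P R by (rule id)
  have meets: "\<exists>i\<in>P. \<exists>r\<in>carrier R. i \<oplus> r \<otimes> a \<in> S" if a: "a \<in> carrier R" "a \<notin> P" for a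
  proof -
    have sum: "P <+> PIdl a = {i \<oplus> r \<otimes> a |i r. i \<in> P \<and> r \<in> carrier R}"
      unfolding set_add_def' cgenideal_def by blast
    have idl: "ideal (P <+> PIdl a) R"
      using add_ideals[OF id cgenideal_ideal[OF a(1)]] .
    have sub: "P \<subseteq> P <+> PIdl a"
    proof
      fix i assume "i \<in> P"
      moreover from this have "i = i \<oplus> \<zero> \<otimes> a" using a P.a_subset by auto
      ultimately show "i \<in> P <+> PIdl a" unfolding sum by blast
    qed
    have "a = \<zero> \<oplus> \<one> \<otimes> a" using a by simp
    then have "a \<in> P <+> PIdl a" unfolding sum using P.zero_closed by blast
    then have "P <+> PIdl a \<notin> A" using max sub a by blast
    then have "(P <+> PIdl a) \<inter> S \<noteq> {}" using idl sub JP unfolding A_def by blast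
    then show ?thesis unfolding sum by blast
  qed
  have "primeideal P R"
  proof (rule primeidealI[OF id is_cring])
    show "carrier R \<noteq> P" using dis S.one_closed by blast
    fix a b assume ab: "a \<in> carrier R" "b \<in> carrier R" "a \<otimes> b \<in> P"
    show "a \<in> P \<or> b \<in> P"
    proof (rule ccontr)
      assume "\<not> (a \<in> P \<or> b \<in> P)"
      then obtain i r j t where
        *: "i \<in> P" "r \<in> carrier R" "i \<oplus> r \<otimes> a \<in> S" "j \<in> P" "t \<in> carrier R" "j \<oplus> t \<otimes> b \<in> S"
        using meets ab by meson
      have c: "i \<in> carrier R" "j \<in> carrier R" using * P.a_subset by auto
      \<comment> \<open>The product is grouped so that every summand has a factor in
        \<open>P\<close>, namely \<open>i\<close>, \<open>j\<close> or
        \<open>a \<otimes> b\<close>.\<close>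
      have "(i \<oplus> r \<otimes> a) \<otimes> (j \<oplus> t \<otimes> b)
          = (j \<oplus> t \<otimes> b) \<otimes> i \<oplus> ((r \<otimes> a) \<otimes> j \<oplus> (r \<otimes> t) \<otimes> (a \<otimes> b))"
        using c * ab by algebra
      also have "\<dots> \<in> P"
        using c * ab by (simp add: P.a_closed P.I_l_closed)
      finally show False using dis S.m_closed * by blast
    qed
  qed
  then show ?thesis using dis JP by blast
qed

text \<open>The relation says exactly that the multiplicative set \<open>S\<close> below contains
  \<open>\<zero>\<close>. The exponent \<open>m = 0\<close> is allowed; it works just when
  \<open>x\<close> is a unit.\<close>

lemma (in cring) maximal_primes_power_absorb:
  assumes max: "\<And>P. primeideal P R \<Longrightarrow> maximalideal P R" and x: "x \<in> carrier R"
  shows "\<exists>m::nat. \<exists>y\<in>carrier R. x [^] m = x [^] m \<otimes> (x \<otimes> y)"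
proof -
  define S where "S = {x [^] m \<otimes> (\<one> \<ominus> x \<otimes> y) |(m::nat) y. y \<in> carrier R}"
  have "submonoid S R"
  proof
    show "S \<subseteq> carrier R" unfolding S_def using x by auto
    have "\<one> = x [^] (0::nat) \<otimes> (\<one> \<ominus> x \<otimes> \<zero>)" using x by (simp add: minus_eq)
    then show "\<one> \<in> S" unfolding S_def by blast
    fix s t assume "s \<in> S" "t \<in> S"
    then obtain m y k z where
      *: "y \<in> carrier R" "z \<in> carrier R" "s = x [^] (m::nat) \<otimes> (\<one> \<ominus> x \<otimes> y)"
        "t = x [^] (k::nat) \<otimes> (\<one> \<ominus> x \<otimes> z)"
      unfolding S_def by blast
    have "x [^] m \<in> carrier R" "x [^] k \<in> carrier R" using x by auto
    \<comment> \<open>Closure rests on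
      \<open>(1 - x y) (1 - x z) = 1 - x (y + z - x y z)\<close>.\<close>
    then have "s \<otimes> t = (x [^] m \<otimes> x [^] k) \<otimes> (\<one> \<ominus> x \<otimes> (y \<oplus> z \<ominus> x \<otimes> (y \<otimes> z)))"
      unfolding *(3,4) using x *(1,2) by algebra
    then have "s \<otimes> t = x [^] (m + k) \<otimes> (\<one> \<ominus> x \<otimes> (y \<oplus> z \<ominus> x \<otimes> (y \<otimes> z)))"
      using x by (simp add: nat_pow_mult)
    moreover have "y \<oplus> z \<ominus> x \<otimes> (y \<otimes> z) \<in> carrier R" using * x by auto
    ultimately show "s \<otimes> t \<in> S" unfolding S_def by blast
  qed
  have "\<zero> \<in> S"
  proof (rule ccontr)
    assume "\<zero> \<notin> S"
    then obtain P where P: "primeideal P R" "P \<inter> S = {}"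
      using exists_primeideal_disjoint[OF \<open>submonoid S R\<close> zeroideal] by auto
    interpret P: maximalideal P R using max P(1) .
    have "x = x [^] (1::nat) \<otimes> (\<one> \<ominus> x \<otimes> \<zero>)" using x by (simp add: minus_eq)
    then have "x \<in> S" unfolding S_def by blast
    then have xP: "x \<notin> P" using P by blast
    \<comment> \<open>As \<open>P\<close> is maximal and misses \<open>x\<close>, the ideal
      \<open>P + (x)\<close> is the whole ring. Writing \<open>\<one>\<close> as
      \<open>i \<oplus> r \<otimes> x\<close> makes \<open>i\<close> equal to
      \<open>1 - x r\<close>, an element of \<open>S\<close> with exponent 0 that lies in
      \<open>P\<close>.\<close>
    have sum: "P <+> PIdl x = {i \<oplus> r \<otimes> x |i r. i \<in> P \<and> r \<in> carrier R}"
      unfolding set_add_def' cgenideal_def by blast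
    have idl: "ideal (P <+> PIdl x) R"
      using add_ideals[OF P.is_ideal cgenideal_ideal[OF x]] .
    have sub: "P \<subseteq> P <+> PIdl x"
    proof
      fix i assume "i \<in> P"
      moreover from this have "i = i \<oplus> \<zero> \<otimes> x" using x P.a_subset by auto
      ultimately show "i \<in> P <+> PIdl x" unfolding sum by blast
    qed
    have "x = \<zero> \<oplus> \<one> \<otimes> x" using x by simp
    then have "x \<in> P <+> PIdl x" unfolding sum using P.zero_closed by blast
    then have "P <+> PIdl x = carrier R"
      using P.I_maximal[OF idl sub] xP ideal.Icarr[OF idl] by blast
    then obtain i r where ir: "i \<in> P" "r \<in> carrier R" "\<one> = i \<oplus> r \<otimes> x"
      using sum one_closed by blast
    have "i \<in> carrier R" using ir P.a_subset by blast
    then have "i = (i \<oplus> r \<otimes> x) \<ominus> x \<otimes> r" using ir(2) x by algebra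
    then have "i = x [^] (0::nat) \<otimes> (\<one> \<ominus> x \<otimes> r)" using ir(2) x unfolding ir(3)[symmetric] by simp
    then have "i \<in> S" unfolding S_def using ir(2) by blast
    then show False using P ir by blast
  qed
  then obtain m y where my: "y \<in> carrier R" "\<zero> = x [^] (m::nat) \<otimes> (\<one> \<ominus> x \<otimes> y)"
    unfolding S_def by blast
  have "x [^] m \<in> carrier R" using x by simp
  then have "x [^] m = x [^] m \<otimes> (\<one> \<ominus> x \<otimes> y) \<oplus> x [^] m \<otimes> (x \<otimes> y)" using x my(1) by algebra
  also have "\<dots> = x [^] m \<otimes> (x \<otimes> y)" unfolding my(2)[symmetric] using x my(1) by simp
  finally show ?thesis using my by blast
qed

lemma (in primeideal) pow_mem_imp_mem:
  assumes "x \<in> carrier R" "x [^] (m::nat) \<in> I"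
  shows "x \<in> I"
  using assms(2)
proof (induction m)
  case 0
  then show ?case using I_notcarr one_imp_carrier by auto
next
  case (Suc m)
  then show ?case using I_prime[of "x [^] m" x] assms(1) by auto
qed

lemma (in cring) exists_separating_idempotent:
  assumes max: "\<And>P. primeideal P R \<Longrightarrow> maximalideal P R"
    and p: "primeideal p R" and q: "primeideal q R" and "p \<noteq> q"
  shows "\<exists>f\<in>carrier R. f \<otimes> f = f \<and> f \<notin> p \<and> f \<in> q"
proof -
  interpret p: primeideal p R by fact
  interpret q: primeideal q R by fact
  \<comment> \<open>Distinct primes are incomparable here because \<open>q\<close> is maximal and
    \<open>p\<close> is proper.\<close>
  have "\<not> q \<subseteq> p"
    using maximalideal.I_maximal[OF max[OF q] p.is_ideal] p.a_subset p.I_notcarr \<open>p \<noteq> q\<close> by blast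
  then obtain x where x: "x \<in> q" "x \<notin> p" by blast
  have xc: "x \<in> carrier R" using x q.a_subset by blast
  obtain m :: nat and y where y: "y \<in> carrier R" and eq: "x [^] m = x [^] m \<otimes> (x \<otimes> y)"
    using maximal_primes_power_absorb[OF max xc] by blast
  have pow: "x [^] m \<otimes> (x \<otimes> y) [^] k = x [^] m" for k :: nat
  proof (induction k)
    case (Suc k)
    have "x [^] m \<otimes> (x \<otimes> y) [^] Suc k = (x [^] m \<otimes> (x \<otimes> y) [^] k) \<otimes> (x \<otimes> y)"
      using xc y by (simp add: m_assoc)
    then show ?case using Suc eq by simp
  qed (use xc in simp)
  \<comment> \<open>The exponent \<open>Suc m\<close> rather than \<open>m\<close> puts \<open>f\<close> into \<open>q\<close> even if \<open>m = 0\<close>.\<close>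
  define f where "f = (x \<otimes> y) [^] Suc m"
  have fc: "f \<in> carrier R" unfolding f_def using xc y by blast
  \<comment> \<open>The factor \<open>x [^] m\<close> absorbs another \<open>f\<close>, which yields
    idempotence; the remaining factor \<open>x\<close> puts \<open>f\<close> into
    \<open>q\<close>.\<close>
  have f: "f = x [^] m \<otimes> (x \<otimes> y [^] Suc m)"
    unfolding f_def using xc y by (simp add: nat_pow_distrib m_ac)
  have absorb: "x [^] m \<otimes> f = x [^] m" unfolding f_def by (rule pow)
  have c: "x [^] m \<in> carrier R" "x \<otimes> y [^] Suc m \<in> carrier R" using xc y by auto
  have "f \<otimes> f = (x [^] m \<otimes> f) \<otimes> (x \<otimes> y [^] Suc m)"
    using c fc by (subst (2) f) (simp add: m_ac)
  then have "f \<otimes> f = f" using absorb f by simp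
  moreover have "f \<notin> p"
  proof
    assume "f \<in> p"
    \<comment> \<open>By absorption \<open>x [^] m\<close> is a multiple of
      \<open>f\<close>.\<close>
    then have "x [^] m \<in> p" using absorb p.I_l_closed[of f "x [^] m"] c by simp
    then show False using p.pow_mem_imp_mem xc x by blast
  qed
  moreover have "f \<in> q"
    unfolding f using c(1) xc y x(1) by (intro q.I_l_closed q.I_r_closed) auto
  ultimately show ?thesis using fc by blast
qed

text \<open>The product of separating idempotents stays outside \<open>q\<close> because
  \<open>q\<close> is prime, whereas a single factor suffices to put it into each of the other
  primes. The empty product is \<open>\<one>\<close>.\<close>

lemma (in cring) exists_idempotent_avoiding_one_prime:
  assumes max: "\<And>P. primeideal P R \<Longrightarrow> maximalideal P R"
    and q: "primeideal q R" and "finite \<P>" and "\<And>P. P \<in> \<P> \<Longrightarrow> primeideal P R" and "q \<notin> \<P>"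
  shows "\<exists>g\<in>carrier R. g \<otimes> g = g \<and> g \<notin> q \<and> (\<forall>P\<in>\<P>. g \<in> P)"
  using assms(3-5)
proof (induction \<P> rule: finite_induct)
  case empty
  have "\<one> \<notin> q"
    using primeideal.I_notcarr[OF q] ideal.one_imp_carrier[OF primeideal.axioms(1)[OF q]] by blast
  then show ?case by (intro bexI[of _ \<one>]) auto
next
  case (insert P \<P>)
  obtain g where g: "g \<in> carrier R" "g \<otimes> g = g" "g \<notin> q" "\<forall>P\<in>\<P>. g \<in> P"
    using insert by auto
  obtain f where f: "f \<in> carrier R" "f \<otimes> f = f" "f \<notin> q" "f \<in> P"
    using exists_separating_idempotent[OF max q, of P] insert.prems by auto
  have "(f \<otimes> g) \<otimes> (f \<otimes> g) = (f \<otimes> f) \<otimes> (g \<otimes> g)" using f(1) g(1) by (simp add: m_ac)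
  moreover have "f \<otimes> g \<notin> q" using primeideal.I_prime[OF q f(1) g(1)] f g by blast
  moreover have "\<forall>Q\<in>insert P \<P>. f \<otimes> g \<in> Q"
  proof
    fix Q assume Q: "Q \<in> insert P \<P>"
    then have "ideal Q R" using insert.prems primeideal.axioms(1) by blast
    then show "f \<otimes> g \<in> Q"
      using Q f g ideal.I_l_closed[of Q R g f] ideal.I_r_closed[of Q R f g] by blast
  qed
  ultimately show ?case using f g by (intro bexI[of _ "f \<otimes> g"]) auto
qed

text \<open>The induction starts from one prime with the system \<open>\<one>\<close>, since an
  empty sum would be \<open>\<zero>\<close>. Distinctness of the idempotents is not carried along;
  it follows from orthogonality and \<open>e i \<notin> p i\<close>.\<close>

lemma (in cring) exists_idempotent_system:
  assumes max: "\<And>P. primeideal P R \<Longrightarrow> maximalideal P R"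
    and "finite I" "I \<noteq> {}" and "\<And>i. i \<in> I \<Longrightarrow> primeideal (p i) R" and "inj_on p I"
  shows "\<exists>e. (\<forall>i\<in>I. e i \<in> carrier R \<and> e i \<otimes> e i = e i \<and> e i \<notin> p i) \<and>
    (\<forall>i\<in>I. \<forall>k\<in>I. i \<noteq> k \<longrightarrow> e i \<otimes> e k = \<zero>) \<and> (\<Oplus>i\<in>I. e i) = \<one>"
  using assms(2-5)
proof (induction I rule: finite_ne_induct)
  case (singleton k)
  then have pk: "primeideal (p k) R" by simp
  have "\<one> \<notin> p k"
    using primeideal.I_notcarr[OF pk] ideal.one_imp_carrier[OF primeideal.axioms(1)[OF pk]] by blast
  then show ?case by (intro exI[of _ "\<lambda>_. \<one>"]) simp
next
  case (insert k I)
  obtain e where e: "\<And>i. i \<in> I \<Longrightarrow> e i \<in> carrier R" "\<And>i. i \<in> I \<Longrightarrow> e i \<otimes> e i = e i"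
      "\<And>i. i \<in> I \<Longrightarrow> e i \<notin> p i"
    and orth: "\<And>i j. i \<in> I \<Longrightarrow> j \<in> I \<Longrightarrow> i \<noteq> j \<Longrightarrow> e i \<otimes> e j = \<zero>"
    and sum: "(\<Oplus>i\<in>I. e i) = \<one>"
    using insert.IH insert.prems by (metis inj_on_insert insertCI)
  have "p k \<notin> p ` I" using insert.hyps insert.prems(2) by auto
  then have "\<exists>g\<in>carrier R. g \<otimes> g = g \<and> g \<notin> p k \<and> (\<forall>P\<in>p ` I. g \<in> P)"
    using insert.hyps(1) insert.prems(1)
    by (intro exists_idempotent_avoiding_one_prime max) auto
  then obtain g where g: "g \<in> carrier R" "g \<otimes> g = g" "g \<notin> p k" "\<And>i. i \<in> I \<Longrightarrow> g \<in> p i"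
    by blast
  define h where "h = \<one> \<ominus> g"
  have h: "h \<in> carrier R" "h \<otimes> h = h" "h \<otimes> g = \<zero>" "g \<otimes> h = \<zero>" "g \<oplus> h = \<one>"
  proof -
    show "h \<in> carrier R" "g \<oplus> h = \<one>" unfolding h_def using g(1) by (simp, algebra)
    have "h \<otimes> g = g \<ominus> g \<otimes> g" "g \<otimes> h = g \<ominus> g \<otimes> g" "h \<otimes> h = \<one> \<ominus> g \<ominus> (g \<ominus> g \<otimes> g)"
      unfolding h_def using g(1) by algebra+
    then show "h \<otimes> g = \<zero>" "g \<otimes> h = \<zero>" "h \<otimes> h = h"
      unfolding g(2) h_def using g(1) by (simp_all add: minus_eq r_neg)
  qed
  define e' where "e' i = (if i = k then g else h \<otimes> e i)" for i
  have e'k: "e' k = g" and e': "\<And>i. i \<in> I \<Longrightarrow> e' i = h \<otimes> e i"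
    using insert.hyps unfolding e'_def by auto
  \<comment> \<open>This gives idempotence for \<open>i = j\<close> and orthogonality for
    \<open>i \<noteq> j\<close>.\<close>
  have prod: "e' i \<otimes> e' j = h \<otimes> (e i \<otimes> e j)" if "i \<in> I" "j \<in> I" for i j
  proof -
    have "e' i \<otimes> e' j = (h \<otimes> h) \<otimes> (e i \<otimes> e j)"
      unfolding e'[OF that(1)] e'[OF that(2)] using e(1) that h(1) by (simp add: m_ac)
    then show ?thesis using h(2) by simp
  qed
  have gi: "g \<otimes> e' i = \<zero>" "e' i \<otimes> g = \<zero>" if "i \<in> I" for i
  proof -
    have "g \<otimes> e' i = (g \<otimes> h) \<otimes> e i"
      unfolding e'[OF that] using e(1)[OF that] h(1) g(1) by (simp add: m_assoc)
    then show "g \<otimes> e' i = \<zero>" using h(4) e(1)[OF that] by simp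
    then show "e' i \<otimes> g = \<zero>"
      using m_comm[of g "e' i"] e'[OF that] e(1)[OF that] h(1) g(1) by simp
  qed
  \<comment> \<open>By primality \<open>h\<close> would lie in \<open>p i\<close>; so does
    \<open>g\<close>, and \<open>g \<oplus> h = \<one>\<close>.\<close>
  have notin: "e' i \<notin> p i" if "i \<in> I" for i
  proof
    assume a: "e' i \<in> p i"
    interpret P: primeideal "p i" R using insert.prems(1) that by blast
    have "h \<in> p i"
      using a P.I_prime[OF h(1) e(1)[OF that]] e(3)[OF that] unfolding e'[OF that] by blast
    then have "g \<oplus> h \<in> p i" by (rule P.a_closed[OF g(4)[OF that]])
    then have "\<one> \<in> p i" unfolding h(5) .
    then show False using P.I_notcarr P.one_imp_carrier by blast
  qed
  have c: "e' \<in> I \<rightarrow> carrier R" using e' e(1) h(1) by auto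
  \<comment> \<open>The old system sums to \<open>\<one>\<close>, so the new one sums to
    \<open>g \<oplus> h = \<one>\<close>.\<close>
  have "(\<Oplus>i\<in>insert k I. e' i) = g \<oplus> (\<Oplus>i\<in>I. e' i)"
    using insert.hyps c g(1) e'k by (subst finsum_insert) auto
  also have "(\<Oplus>i\<in>I. e' i) = (\<Oplus>i\<in>I. h \<otimes> e i)"
    using e' e(1) h(1) by (intro finsum_cong') auto
  also have "\<dots> = h \<otimes> (\<Oplus>i\<in>I. e i)"
    using insert.hyps e(1) h(1) by (intro finsum_rdistr[symmetric]) auto
  finally have "(\<Oplus>i\<in>insert k I. e' i) = \<one>" using sum h(1,5) by simp
  then show ?case
    using notin gi prod orth e(1,2) h(1) g(1-3) e'k e' insert.hyps
    by (intro exI[of _ e']) auto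
qed

theorem theorem5p9:
  fixes R :: "('a, 'b) ring_scheme" (structure)
    and n :: nat
    and p :: "nat \<Rightarrow> 'a set"
  assumes "cring R"
    and "zero_dimensional R"
    and "n \<ge> 1"
    and "\<And>i. i \<in> {1..n} \<Longrightarrow> primeideal (p i) R"
    and "inj_on p {1..n}"
  shows "\<exists>e :: nat \<Rightarrow> 'a. orthogonal_idempotents R {1..n} e \<and>
           (\<forall>i\<in>{1..n}. p i \<in> basic_open R (e i)) \<and>
           (\<Oplus>i\<in>{1..n}. e i) = \<one>"
proof -
  interpret cring R by fact
  have p1: "primeideal (p 1) R" using assms(3,4) by simp
  interpret p1: primeideal "p 1" R by (rule p1)
  \<comment> \<open>The proper ideal \<open>p 1\<close> exists because \<open>n \<ge> 1\<close>, so
    the ring is nonzero and dimension zero means that all primes are maximal.\<close>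
  have "\<one> \<noteq> \<zero>" using p1.I_notcarr p1.one_imp_carrier p1.zero_closed by auto
  then have max: "maximalideal P R" if "primeideal P R" for P
    using zero_dimensional_iff[OF assms(1)] assms(2) that by (simp add: Spec_def)
  obtain e where e: "\<forall>i\<in>{1..n}. e i \<in> carrier R \<and> e i \<otimes> e i = e i \<and> e i \<notin> p i"
    and orth: "\<forall>i\<in>{1..n}. \<forall>k\<in>{1..n}. i \<noteq> k \<longrightarrow> e i \<otimes> e k = \<zero>"
    and sum: "(\<Oplus>i\<in>{1..n}. e i) = \<one>"
    using exists_idempotent_system[OF max, of "{1..n}" p] assms(3-5) by auto
  have "inj_on e {1..n}"
  proof (rule inj_onI, rule ccontr)
    fix i k assume ik: "i \<in> {1..n}" "k \<in> {1..n}" "e i = e k" "i \<noteq> k"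
    \<comment> \<open>Here
      \<open>e i = e i \<otimes> e i = e i \<otimes> e k = \<zero>\<close>.\<close>
    then have "e i = \<zero>" using e orth by metis
    moreover have "\<zero> \<in> p i"
      using additive_subgroup.zero_closed ideal.axioms(1) primeideal.axioms(1) assms(4) ik(1)
      by blast
    ultimately show False using e ik(1) by metis
  qed
  then show ?thesis
    using e orth sum assms(4)
    by (intro exI[of _ e]) (auto simp: orthogonal_idempotents_def basic_open_def Spec_def)
qed

end
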